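(* For each positive integer $d$, let $g(d)$ denote the number of integers $x$ with $1 \leq x \leq d$ such that $x^2 \equiv 1 \pmod d$. Then $$\sum_{d < N} g(d) \sim \frac{6}{\pi^2} N \log N$$ as $N \rightarrow \infty$, where the sum runs over positive integers $d < N$; that is, the ratio of the two sides tends to $1$ as $N \to \infty$.
   Context: Here $\log$ is the natural logarithm. *)

theory Defs
  imports "HOL-Analysis.Analysis" "HOL-Number_Theory.Number_Theory" "HOL-Library.Landau_Symbols"
begin

definition g :: "nat \<Rightarrow> nat" where
  "g d = card {x \<in> {1..d}. [x\<^sup>2 = 1] (mod d)}"

end

theory Submission
  imports Defs "HOL-Real_Asymp.Real_Asymp"
begin

text \<open>
  For odd \<open>d\<close>, a square root of \<open>1\<close> modulo \<open>d\<close> amounts to a factorisation of \<open>d\<close> into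
  two coprime factors, so \<open>g d\<close> is the number \<open>h d\<close> of unitary divisors of \<open>d\<close>; at the
  prime 2 one gets \<open>g(d) = h(d) - h(d/2) + 2 h(d/4)\<close>, where \<open>h\<close> vanishes at non-integers.
  Sorting the pairs \<open>(a, b)\<close> with \<open>a b \<le> x\<close> by their gcd, the summatory function \<open>H\<close> of
  \<open>h\<close> satisfies \<open>\<Sum>\<^sub>k H(x/k\<^sup>2) = x ln x + O(x)\<close>.
  Since \<open>\<Sum>\<^sub>k 1/k\<^sup>2 = \<pi>\<^sup>2/6\<close>, the error \<open>e(x) = H(x) - 6/\<pi>\<^sup>2 x ln x\<close> has
  \<open>\<Sum>\<^sub>k e(x/k\<^sup>2) = O(x)\<close>. No Moebius inversion is needed to conclude \<open>e(x) = O(x)\<close>: as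
  \<open>\<Sum>\<^sub>k\<^sub>\<ge>\<^sub>2 1/k\<^sup>2 < 1\<close>, the terms with \<open>k \<ge> 2\<close> are absorbed by induction on \<open>x\<close>.
\<close>

declare One_nat_def [simp del]

section \<open>Unitary divisors and square roots of 1 modulo \<open>d\<close>\<close>

definition unitary_divisors :: "nat \<Rightarrow> nat set" where
  "unitary_divisors n = {a. a dvd n \<and> coprime a (n div a)}"

definition unitary_count :: "nat \<Rightarrow> nat" where
  "unitary_count n = card (unitary_divisors n)"

lemma unitary_divisors_iff:
  assumes "n > 0"
  shows "a \<in> unitary_divisors n \<longleftrightarrow> (\<exists>b. n = a * b \<and> coprime a b)"
  using assms by (force simp: unitary_divisors_def)

lemma finite_unitary_divisors: "n > 0 \<Longrightarrow> finite (unitary_divisors n)"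
  by (rule finite_subset[OF _ finite_divisors_nat]) (auto simp: unitary_divisors_def)

text \<open>Representatives start at 0 rather than 1, so that they are exactly the values of
  \<open>mod d\<close>, as the Chinese remainder theorem wants them.\<close>

definition sqrt_one :: "nat \<Rightarrow> nat set" where
  "sqrt_one d = {x. x < d \<and> [x\<^sup>2 = 1] (mod d)}"

lemma cong_sq_mod_iff: "[(x mod d)\<^sup>2 = 1] (mod d) \<longleftrightarrow> [x\<^sup>2 = 1] (mod (d::nat))"
  by (simp add: cong_def power_mod)

lemma g_eq_card_sqrt_one:
  assumes "d > 0"
  shows "g d = card (sqrt_one d)"
proof -
  have "bij_betw (\<lambda>x. x mod d) {x \<in> {1..d}. [x\<^sup>2 = 1] (mod d)} (sqrt_one d)"
  \<comment> \<open>Only the class of 0 changes its representative, and 0 is a root only for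
    \<open>d = 1\<close>.\<close>
  proof (rule bij_betwI[where g = "\<lambda>x. if x = 0 then d else x"], goal_cases)
    case 1
    then show ?case using assms by (auto simp: sqrt_one_def cong_sq_mod_iff)
  next
    case 2
    then show ?case using assms
      by (auto simp: sqrt_one_def cong_def split: if_splits)
  next
    case (3 x)
    then show ?case using assms
      by (cases "x = d") auto
  next
    case (4 y)
    then show ?case using assms by (auto simp: sqrt_one_def)
  qed
  then show ?thesis by (simp add: g_def bij_betw_same_card)
qed

text \<open>By the Chinese remainder theorem, a root modulo \<open>m * n\<close> is a pair of roots
  modulo \<open>m\<close> and modulo \<open>n\<close>.\<close>

lemma g_mult_coprime:
  assumes "coprime m n" "m > 0" "n > 0"
  shows "g (m * n) = g m * g n"
proof -
  have "bij_betw (\<lambda>x. (x mod m, x mod n)) (sqrt_one (m * n)) (sqrt_one m \<times> sqrt_one n)"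
  proof (rule bij_betwI')
    fix x y assume "x \<in> sqrt_one (m * n)" "y \<in> sqrt_one (m * n)"
    then show "((x mod m, x mod n) = (y mod m, y mod n)) = (x = y)"
      using coprime_cong_mult_nat[of x y m n] assms
      by (auto simp: sqrt_one_def cong_def)
  next
    fix x assume "x \<in> sqrt_one (m * n)"
    then have "[x\<^sup>2 = 1] (mod m * n)" by (simp add: sqrt_one_def)
    then have "[x\<^sup>2 = 1] (mod m)" "[x\<^sup>2 = 1] (mod n)"
      by (auto intro: cong_modulus_mult_nat simp: mult.commute)
         (metis cong_modulus_mult_nat mult.commute)
    then show "(x mod m, x mod n) \<in> sqrt_one m \<times> sqrt_one n"
      using assms by (simp add: sqrt_one_def cong_sq_mod_iff)
  next
    fix z assume z: "z \<in> sqrt_one m \<times> sqrt_one n"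
    obtain a b where ab: "z = (a, b)" by (cases z)
    from binary_chinese_remainder_unique_nat[OF assms(1), of a b] assms(2,3)
    obtain x where x: "x < m * n" "[x = a] (mod m)" "[x = b] (mod n)"
      by auto
    have am: "x mod m = a" "x mod n = b"
      using x z ab by (auto simp: sqrt_one_def cong_def)
    have "[x\<^sup>2 = 1] (mod m)" "[x\<^sup>2 = 1] (mod n)"
      using am z ab cong_sq_mod_iff[of x m] cong_sq_mod_iff[of x n] by (auto simp: sqrt_one_def)
    then have "[x\<^sup>2 = 1] (mod m * n)"
      using assms(1) by (rule coprime_cong_mult_nat)
    then show "\<exists>x\<in>sqrt_one (m * n). z = (x mod m, x mod n)"
      using x am ab by (auto simp: sqrt_one_def intro!: bexI[of _ x])
  qed
  then have "card (sqrt_one (m * n)) = card (sqrt_one m \<times> sqrt_one n)"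
    by (rule bij_betw_same_card)
  then show ?thesis
    using assms by (simp add: g_eq_card_sqrt_one card_cartesian_product)
qed

lemma cong_sq_one_iff_dvd:
  fixes x d :: nat
  shows "[x\<^sup>2 = 1] (mod d) \<longleftrightarrow> int d dvd (int x - 1) * (int x + 1)"
proof -
  have "[x\<^sup>2 = 1] (mod d) \<longleftrightarrow> [int (x\<^sup>2) = int 1] (mod int d)"
    by (simp only: cong_int_iff)
  also have "\<dots> \<longleftrightarrow> int d dvd (int x - 1) * (int x + 1)"
    by (simp add: cong_iff_dvd_diff power2_eq_square algebra_simps)
  finally show ?thesis .
qed

text \<open>A common divisor divides \<open>(x + 1) - (x - 1) = 2\<close>, and oddness rules out
  2.\<close>

lemma coprime_of_dvd_pm1:
  fixes a b :: nat and x :: int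
  assumes "odd (a * b)" "int a dvd x - 1" "int b dvd x + 1"
  shows "coprime a b"
proof (rule coprimeI)
  fix c assume c: "c dvd a" "c dvd b"
  then have "int c dvd x - 1" "int c dvd x + 1"
    using assms by (meson dvd_trans int_dvd_int_iff)+
  then have "int c dvd (x + 1) - (x - 1)" by (rule dvd_diff[rotated])
  then have "int c dvd int 2" by simp
  then have "c dvd 2" unfolding int_dvd_int_iff .
  moreover have "odd c" using c assms by (meson dvd_mult2 dvd_trans)
  ultimately have "c = 1"
    by (metis dvd_refl prime_nat_iff two_is_prime_nat)
  then show "is_unit c" by simp
qed

text \<open>A root \<open>x\<close> is matched with the unitary divisor
  \<open>gcd (x - 1) m\<close>. The cofactor divides \<open>x + 1\<close>, so \<open>x\<close> is 1
  modulo the divisor and -1 modulo the cofactor, which determines \<open>x\<close> and, read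
  backwards, constructs it.\<close>

lemma g_odd:
  assumes "odd m"
  shows "g m = unitary_count m"
proof -
  have m: "m > 0" using assms by (simp add: odd_pos)
  define F where "F x = nat (gcd (int x - 1) (int m))" for x :: nat
  have iF: "int (F x) = gcd (int x - 1) (int m)" for x by (simp add: F_def)
  have Fd: "F x dvd m" for x
    using gcd_dvd2[of "int x - 1" "int m"] by (simp only: iF[symmetric] int_dvd_int_iff)
  have F2: "int (m div F x) dvd int x + 1" if "x \<in> sqrt_one m" for x
  proof -
    \<comment> \<open>After the gcd is divided out, the cofactor \<open>b\<close> of
      \<open>m\<close> is coprime to the cofactor \<open>c\<close> of \<open>x - 1\<close>, so
      \<open>b\<close> must divide \<open>x + 1\<close>.\<close>
    have "gcd (int x - 1) (int m) \<noteq> 0" using m by simp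
    then obtain c b where cb: "int x - 1 = c * int (F x)" "int m = b * int (F x)" "coprime c b"
      unfolding iF using gcd_coprime_exists by metis
    have F0: "int (F x) \<noteq> 0" using cb(2) m by (intro notI) simp
    have "int m dvd (int x - 1) * (int x + 1)"
      using that by (simp add: sqrt_one_def cong_sq_one_iff_dvd)
    then have "int (F x) * b dvd int (F x) * (c * (int x + 1))"
      unfolding cb(1,2) by (simp only: mult_ac)
    then have "b dvd c * (int x + 1)" using F0 by (simp only: dvd_mult_cancel_left simp_thms)
    then have "b dvd int x + 1" using cb(3) by (metis coprime_commute coprime_dvd_mult_right_iff)
    moreover have "int (m div F x) = b" using cb(2) F0 by (simp add: zdiv_int)
    ultimately show ?thesis by simp
  qed
  have F1: "int (F x) dvd int x - 1" for x by (simp add: iF)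
  have bij: "bij_betw F (sqrt_one m) (unitary_divisors m)"
  proof (rule bij_betw_imageI)
    have cop: "coprime (F x) (m div F x)" if "x \<in> sqrt_one m" for x
      using coprime_of_dvd_pm1[OF _ F1 F2[OF that]] Fd[of x] assms by simp
    show "inj_on F (sqrt_one m)"
    proof (rule inj_onI)
      fix x y assume xy: "x \<in> sqrt_one m" "y \<in> sqrt_one m" "F x = F y"
      have "[int x = int y] (mod int (F x))"
        using F1[of x] F1[of y] xy(3) dvd_diff[of "int (F x)" "int x - 1" "int y - 1"]
        by (simp add: cong_iff_dvd_diff)
      moreover have "[int x = int y] (mod int (m div F x))"
        using F2[OF xy(1)] F2[OF xy(2)] xy(3) dvd_diff[of "int (m div F x)" "int x + 1" "int y + 1"]
        by (simp add: cong_iff_dvd_diff)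
      ultimately have "[x = y] (mod F x * (m div F x))"
        using cop[OF xy(1)] by (simp only: cong_int_iff coprime_cong_mult_nat)
      then show "x = y" using Fd[of x] xy(1,2) by (simp add: sqrt_one_def cong_def)
    qed
    show "F ` sqrt_one m = unitary_divisors m"
    proof (intro equalityI subsetI)
      fix a assume "a \<in> F ` sqrt_one m"
      then show "a \<in> unitary_divisors m" using Fd cop by (auto simp: unitary_divisors_def)
    next
      fix a assume "a \<in> unitary_divisors m"
      then obtain b where b: "m = a * b" "coprime a b" and ab: "a > 0" "b > 0"
        using m by (auto simp: unitary_divisors_iff)
      \<comment> \<open>Over the naturals, \<open>b - 1\<close> stands for the residue -1 modulo
        \<open>b\<close>.\<close>
      from binary_chinese_remainder_unique_nat[OF b(2), of 1 "b - 1"] ab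
      obtain x where x: "x < a * b" "[x = 1] (mod a)" "[x = b - 1] (mod b)" by auto
      have x1: "int a dvd int x - 1"
        using x(2) unfolding cong_int_iff[symmetric] by (simp add: cong_iff_dvd_diff)
      have "[int x = int b - 1] (mod int b)"
        using x(3) ab unfolding cong_int_iff[symmetric] by (simp add: of_nat_diff)
      then have x2: "int b dvd int x + 1"
        unfolding cong_iff_dvd_diff by (metis diff_diff_eq2 dvd_add_triv_right_iff diff_add_cancel)
      have xs: "x \<in> sqrt_one m"
        using x(1) x1 x2 b(1) by (simp add: sqrt_one_def cong_sq_one_iff_dvd mult_dvd_mono)
      \<comment> \<open>This excludes a gcd larger than \<open>a\<close>: \<open>F x\<close> divides
        \<open>x - 1\<close> while \<open>b\<close> divides \<open>x + 1\<close>.\<close>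
      have "coprime (F x) b"
        using coprime_of_dvd_pm1[OF _ F1 x2] assms Fd[of x] b(1)
        by (metis dvd_trans even_mult_iff)
      then have "F x dvd a" using Fd[of x] b(1) by (simp add: coprime_dvd_mult_left_iff)
      moreover have "int a dvd int (F x)" unfolding iF using x1 b(1) by simp
      ultimately have "F x = a" by (simp add: dvd_antisym)
      then show "a \<in> F ` sqrt_one m" using xs by blast
    qed
  qed
  show ?thesis using bij_betw_same_card[OF bij] m
    by (simp add: g_eq_card_sqrt_one unitary_count_def)
qed

section \<open>The contribution of the prime 2\<close>

text \<open>In a coprime factorisation the whole power \<open>2 ^ k\<close> falls into one factor,
  which leaves two choices for each unitary divisor of the odd part.\<close>

lemma unitary_count_pow2_mult:
  assumes "odd m" "k > 0"
  shows "unitary_count (2 ^ k * m) = 2 * unitary_count m"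
proof -
  let ?S = unitary_divisors
  have m: "m > 0" using assms by (simp add: odd_pos)
  then have m': "2 ^ k * m > 0" by simp
  have fin: "finite (?S m)" using m by (rule finite_unitary_divisors)
  have odd_dvd: "odd a" if "a dvd m" for a using that assms(1) dvd_trans by blast
  have "?S (2 ^ k * m) = ?S m \<union> (*) (2 ^ k) ` ?S m"
  proof (intro equalityI subsetI)
    fix a assume "a \<in> ?S (2 ^ k * m)"
    then obtain b where b: "2 ^ k * m = a * b" "coprime a b"
      using m' unitary_divisors_iff by blast
    show "a \<in> ?S m \<union> (*) (2 ^ k) ` ?S m"
    proof (cases "odd a")
      case True
      then have "coprime (2 ^ k) a" by simp
      then have "2 ^ k dvd b" using b(1) by (metis coprime_dvd_mult_right_iff dvd_triv_left)
      then obtain c where c: "b = 2 ^ k * c" by blast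
      then have "m = a * c" using b(1) by simp
      then show ?thesis using b(2) c m by (auto simp: unitary_divisors_iff)
    next
      case False
      then have "odd b" using b(2) by (meson coprime_common_divisor odd_one)
      then have "coprime (2 ^ k) b" by simp
      then have "2 ^ k dvd a" using b(1) by (metis coprime_dvd_mult_left_iff dvd_triv_left)
      then obtain c where c: "a = 2 ^ k * c" by blast
      then have "m = c * b" using b(1) by simp
      then have "c \<in> ?S m" using b(2) c m by (auto simp: unitary_divisors_iff)
      then show ?thesis using c by auto
    qed
  next
    fix a assume "a \<in> ?S m \<union> (*) (2 ^ k) ` ?S m"
    then show "a \<in> ?S (2 ^ k * m)"
    proof
      assume a: "a \<in> ?S m"
      then obtain c where c: "m = a * c" "coprime a c" using m by (auto simp: unitary_divisors_iff)
      have "odd a" using c assms by simp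
      then have "2 ^ k * m = a * (2 ^ k * c)" "coprime a (2 ^ k * c)" using c by auto
      then show ?thesis using m' unitary_divisors_iff by blast
    next
      assume "a \<in> (*) (2 ^ k) ` ?S m"
      then obtain e where e: "a = 2 ^ k * e" "e \<in> ?S m" by blast
      then obtain c where c: "m = e * c" "coprime e c" using m by (auto simp: unitary_divisors_iff)
      have "odd c" using c assms by simp
      then have "2 ^ k * m = a * c" "coprime a c" using c e by auto
      then show ?thesis using m' unitary_divisors_iff by blast
    qed
  qed
  moreover have "?S m \<inter> (*) (2 ^ k) ` ?S m = {}"
    using odd_dvd[of "2 ^ k * _"] assms(2) by (auto simp: unitary_divisors_def)
  moreover have "card ((*) (2 ^ k) ` ?S m) = card (?S m)"
    by (rule card_image) (auto simp: inj_on_def)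
  ultimately show ?thesis using fin by (simp add: unitary_count_def card_Un_disjoint)
qed

lemma sqrt_one_2: "sqrt_one 2 = {1}"
  by (auto simp: sqrt_one_def cong_def less_Suc_eq numeral_2_eq_2)

lemma sqrt_one_4: "sqrt_one 4 = {1, 3}"
proof -
  have "x \<in> {1, 3}" if "x \<in> sqrt_one 4" for x
  proof -
    have "x < 4" using that by (simp add: sqrt_one_def)
    then have "x = 0 \<or> x = 1 \<or> x = 2 \<or> x = 3" by linarith
    then show ?thesis using that by (elim disjE) (simp_all add: sqrt_one_def cong_def)
  qed
  then show ?thesis by (auto simp: sqrt_one_def cong_def)
qed

text \<open>The roots are 1 and -1, and the same two shifted by half the modulus, which is called
  \<open>q\<close> below.\<close>

lemma card_sqrt_one_pow2:
  assumes "k \<ge> 3"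
  shows "card (sqrt_one (2 ^ k)) = 4"
proof -
  obtain j where j: "k = j + 3" using assms by (metis add.commute le_Suc_ex)
  define q :: nat where "q = 2 ^ (j + 2)"
  have kq: "2 ^ k = 2 * q" and q4: "q \<ge> 4" "even q"
    by (auto simp: j q_def power_add)
  have "sqrt_one (2 * q) = {1, q - 1, q + 1, 2 * q - 1}"
  proof (intro equalityI subsetI)
    fix x assume "x \<in> sqrt_one (2 * q)"
    then have x: "x < 2 * q" "int (2 * q) dvd (int x - 1) * (int x + 1)"
      by (auto simp: sqrt_one_def cong_sq_one_iff_dvd)
    then have "even ((int x - 1) * (int x + 1))" by (metis dvd_trans dvd_triv_left of_nat_mult of_nat_numeral)
    then have "odd x" by auto
    \<comment> \<open>With \<open>x = 2 * y + 1\<close> the product is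
      \<open>4 * (y * (y + 1))\<close>. One of two consecutive numbers is odd, so the remaining
      power of 2 divides the other.\<close>
    then obtain y where y: "x = 2 * y + 1" by (metis oddE)
    have "int (2 * q) = int (4 * 2 ^ (j + 1))" "(int x - 1) * (int x + 1) = int (4 * (y * (y + 1)))"
      by (simp_all add: y q_def power_add algebra_simps)
    then have "int (4 * 2 ^ (j + 1)) dvd int (4 * (y * (y + 1)))"
      using x(2) by (simp only:)
    then have d: "2 ^ (j + 1) dvd y * (y + 1)"
      unfolding int_dvd_int_iff by simp
    have "2 ^ (j + 1) dvd y \<or> 2 ^ (j + 1) dvd y + 1"
    proof (cases "even y")
      case True
      then have "coprime (2 ^ (j + 1)) (y + 1)" by simp
      then have "2 ^ (j + 1) dvd y" using d by (simp only: coprime_dvd_mult_left_iff)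
      then show ?thesis ..
    next
      case False
      then have "coprime (2 ^ (j + 1)) y" by simp
      then have "2 ^ (j + 1) dvd y + 1" using d by (simp only: coprime_dvd_mult_right_iff)
      then show ?thesis ..
    qed
    then show "x \<in> {1, q - 1, q + 1, 2 * q - 1}"
    proof
      assume "2 ^ (j + 1) dvd y"
      then obtain t where t: "y = 2 ^ (j + 1) * t" by blast
      then have xt: "x = q * t + 1" using y by (simp add: q_def power_add)
      then have "q * t < q * 2" using x(1) by linarith
      then have "t < 2" by simp
      then show ?thesis using xt by (auto simp: less_2_cases_iff)
    next
      assume "2 ^ (j + 1) dvd y + 1"
      then obtain t where t: "y + 1 = 2 ^ (j + 1) * t" by blast
      have xt: "x + 1 = q * t" using y t by (simp add: q_def power_add)
      then have "q * t < q * 3" using x(1) q4 by linarith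
      then have "t < 3" by simp
      moreover have "t \<noteq> 0" using xt by (intro notI) simp
      ultimately have "t = 1 \<or> t = 2" by linarith
      then show ?thesis using xt by auto
    qed
  next
    fix x assume "x \<in> {1, q - 1, q + 1, 2 * q - 1}"
    then consider "x = 1" | "x = q - 1" | "x = q + 1" | "x = 2 * q - 1" by auto
    then show "x \<in> sqrt_one (2 * q)"
    proof cases
      case 2
      have "int (2 * q) dvd (int q - 2) * int q"
        using q4 mult_dvd_mono[of 2 "int q - 2" "int q" "int q"] by simp
      then show ?thesis using 2 q4 by (simp add: sqrt_one_def cong_sq_one_iff_dvd of_nat_diff)
    next
      case 3
      have "int (2 * q) dvd int q * (int q + 2)"
        using q4 mult_dvd_mono[of 2 "int q + 2" "int q" "int q"] by (simp add: mult.commute)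
      then show ?thesis using 3 q4 by (simp add: sqrt_one_def cong_sq_one_iff_dvd algebra_simps)
    next
      case 4
      then show ?thesis using q4 by (simp add: sqrt_one_def cong_sq_one_iff_dvd of_nat_diff)
    qed (use q4 in \<open>simp add: sqrt_one_def\<close>)
  qed
  moreover have "distinct [1, q - 1, q + 1, 2 * q - 1]" using q4 by auto
  then have "card {1, q - 1, q + 1, 2 * q - 1} = 4" using q4 by simp
  ultimately show ?thesis by (simp add: kq)
qed

text \<open>
  The coefficients come from the Euler factors at 2:
  \<open>1 + x + 2x\<^sup>2 + 4x\<^sup>3/(1-x) = (1 - x + 2x\<^sup>2) (1+x)/(1-x)\<close>.
\<close>
lemma g_conv_unitary_count:
  assumes "d > 0"
  shows "real (g d) = real (unitary_count d)
    - (if 2 dvd d then real (unitary_count (d div 2)) else 0)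
    + 2 * (if 4 dvd d then real (unitary_count (d div 4)) else 0)"
proof -
  obtain k m where d: "d = 2 ^ k * m" and m: "odd m"
    using assms by (metis multiplicity_decompose' nat_dvd_1_iff_1 neq0_conv numeral_eq_one_iff semiring_norm(85))
  have m0: "m > 0" using m by (simp add: odd_pos)
  have gd: "g d = g (2 ^ k) * unitary_count m"
    using m m0 unfolding d by (subst g_mult_coprime) (auto simp: g_odd)
  \<comment> \<open>In these four cases \<open>g (2 ^ k)\<close> is 1, 1, 2, 4. The right-hand side,
    in units of \<open>unitary_count m\<close>, is 1, 2 - 1, 2 - 2 + 2 and 2 - 2 + 4.\<close>
  consider "k = 0" | "k = 1" | "k = 2" | "k \<ge> 3" by linarith
  then show ?thesis
  proof cases
    case 1
    then show ?thesis using d m by (auto simp: g_odd dest: dvd_trans[of 2 4 m])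
  next
    case 2
    have "\<not> 4 dvd 2 * m" using m by (auto simp: dvd_def)
    then show ?thesis using 2 d gd m unitary_count_pow2_mult[OF m, of 1]
      by (simp add: g_eq_card_sqrt_one sqrt_one_2)
  next
    case 3
    then show ?thesis using 3 d gd m unitary_count_pow2_mult[OF m, of 1] unitary_count_pow2_mult[OF m, of 2]
      by (simp add: g_eq_card_sqrt_one sqrt_one_4)
  next
    case 4
    obtain j where j: "k = j + 3" using 4 by (metis add.commute le_Suc_ex)
    have "d div 2 = 2 ^ (j + 2) * m" "d div 4 = 2 ^ (j + 1) * m" "2 dvd d" "4 dvd d"
      by (auto simp: d j power_add)
    then show ?thesis
      using gd unitary_count_pow2_mult[OF m, of "j+2"] unitary_count_pow2_mult[OF m, of "j+1"]
        unitary_count_pow2_mult[OF m, of k] card_sqrt_one_pow2[OF 4] 4 d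
      by (simp add: g_eq_card_sqrt_one)
  qed
qed

section \<open>Summatory functions with a real cutoff\<close>

text \<open>A real cutoff lets \<open>x / 2\<close>, \<open>x / 4\<close> and \<open>x / k^2\<close>
  be substituted without floors.\<close>

definition nats_upto :: "real \<Rightarrow> nat set" where
  "nats_upto x = {d. 0 < d \<and> real d \<le> x}"

lemma nats_upto_eq: "nats_upto x = {1..nat \<lfloor>x\<rfloor>}"
  unfolding nats_upto_def by (auto simp: le_nat_floor nat_le_iff) linarith+

lemma finite_nats_upto [simp]: "finite (nats_upto x)"
  by (simp add: nats_upto_eq)

definition unitary_sum :: "real \<Rightarrow> real" where
  "unitary_sum x = (\<Sum>d\<in>nats_upto x. real (unitary_count d))"

lemma sum_dilate:
  assumes "k > 0"
  shows "(\<Sum>d\<in>nats_upto x. if k dvd d then f (d div k) else 0) = (\<Sum>d\<in>nats_upto (x / real k). f d :: real)"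
proof -
  have "(\<Sum>d\<in>nats_upto x. if k dvd d then f (d div k) else 0)
      = (\<Sum>d\<in>{d\<in>nats_upto x. k dvd d}. f (d div k))"
    by (simp add: sum.inter_filter)
  also have "\<dots> = (\<Sum>d\<in>nats_upto (x / real k). f d)"
    using assms
    by (intro sum.reindex_bij_witness[where i = "\<lambda>e. k * e" and j = "\<lambda>d. d div k"])
       (auto simp: nats_upto_def field_simps elim!: dvdE)
  finally show ?thesis .
qed

lemma sum_g_conv:
  "(\<Sum>d\<in>nats_upto x. real (g d)) = unitary_sum x - unitary_sum (x / 2) + 2 * unitary_sum (x / 4)"
proof -
  have "(\<Sum>d\<in>nats_upto x. real (g d)) = (\<Sum>d\<in>nats_upto x. real (unitary_count d)
    - (if 2 dvd d then real (unitary_count (d div 2)) else 0)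
    + 2 * (if 4 dvd d then real (unitary_count (d div 4)) else 0))"
    by (intro sum.cong refl g_conv_unitary_count) (auto simp: nats_upto_def)
  then show ?thesis
    using sum_dilate[of 2 "\<lambda>d. real (unitary_count d)" x] sum_dilate[of 4 "\<lambda>d. real (unitary_count d)" x]
    by (simp only: sum.distrib sum_subtractf sum_distrib_left[symmetric] unitary_sum_def) simp
qed

section \<open>Lattice points under a hyperbola\<close>

text \<open>These are the positive lattice points with \<open>a * b \<le> x\<close>, stored by
  columns so that their number is a divisor sum.\<close>

definition pairs_upto :: "real \<Rightarrow> (nat \<times> nat) set" where
  "pairs_upto x = (SIGMA a:nats_upto x. nats_upto (x / real a))"

lemma pairs_upto_iff: "(a, b) \<in> pairs_upto x \<longleftrightarrow> a > 0 \<and> b > 0 \<and> real (a * b) \<le> x"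
proof -
  have "real a \<le> x" if "a > 0" "b > 0" "real a * real b \<le> x"
  proof -
    have "real a * 1 \<le> real a * real b" using that by (intro mult_left_mono) auto
    then show ?thesis using that(3) by linarith
  qed
  then show ?thesis by (auto simp: pairs_upto_def nats_upto_def field_simps)
qed

lemma finite_pairs_upto [simp]: "finite (pairs_upto x)"
  by (simp add: pairs_upto_def)

text \<open>A unitary divisor \<open>a\<close> of \<open>d\<close> is the same as the coprime pair
  \<open>(a, d div a)\<close> with product \<open>d\<close>.\<close>

lemma unitary_sum_eq_card:
  "unitary_sum x = real (card {(a, b) \<in> pairs_upto x. coprime a b})"
proof -
  have "bij_betw (\<lambda>(d, a). (a, d div a)) (SIGMA d:nats_upto x. unitary_divisors d)
     {(a, b) \<in> pairs_upto x. coprime a b}"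
    by (rule bij_betwI[where g = "\<lambda>(a, b). (a * b, a)"])
       (auto simp: pairs_upto_iff nats_upto_def unitary_divisors_iff)
  then have "card {(a, b) \<in> pairs_upto x. coprime a b}
      = card (SIGMA d:nats_upto x. unitary_divisors d)"
    by (simp add: bij_betw_same_card)
  also have "\<dots> = (\<Sum>d\<in>nats_upto x. unitary_count d)"
    unfolding unitary_count_def
    by (rule card_SigmaI[OF finite_nats_upto]) (auto simp: nats_upto_def intro!: finite_unitary_divisors)
  finally show ?thesis by (simp add: unitary_sum_def)
qed

text \<open>Dividing a pair by its gcd \<open>k\<close> gives a coprime pair with product at most
  \<open>x / k^2\<close>. Since \<open>k^2\<close> divides the original product, \<open>k\<close>
  stays below \<open>sqrt x\<close>.\<close>

lemma card_pairs_upto_gcd: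
  assumes "x \<ge> 1"
  shows "real (card (pairs_upto x)) = (\<Sum>k\<in>nats_upto (sqrt x). unitary_sum (x / (real k)\<^sup>2))"
proof -
  let ?C = "\<lambda>k. {(a, b) \<in> pairs_upto (x / (real k)\<^sup>2). coprime a b}"
  have iff: "real a * real b \<le> x / (real k)\<^sup>2 \<longleftrightarrow> real (k * a) * real (k * b) \<le> x" if "k > 0" for a b k
    using that by (simp add: field_simps power2_eq_square)
  have le: "real k \<le> sqrt x" if "a > 0" "b > 0" "real (k * a) * real (k * b) \<le> x" for a b k
  proof -
    have "k * k \<le> (k * a) * (k * b)"
      using that by (intro mult_mono) auto
    then have "real k * real k \<le> real (k * a) * real (k * b)"
      unfolding of_nat_mult[symmetric] of_nat_le_iff .
    then show ?thesis using that by (intro real_le_rsqrt) (simp add: power2_eq_square)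
  qed
  have "bij_betw (\<lambda>(k, a, b). (k * a, k * b)) (SIGMA k:nats_upto (sqrt x). ?C k) (pairs_upto x)"
  proof (rule bij_betwI[where g = "\<lambda>(a, b). (gcd a b, a div gcd a b, b div gcd a b)"], goal_cases)
    case 1
    then show ?case by (auto simp: pairs_upto_iff nats_upto_def iff)
  next
    case 2
    have "(gcd a b, a div gcd a b, b div gcd a b) \<in> (SIGMA k:nats_upto (sqrt x). ?C k)"
      if ab: "(a, b) \<in> pairs_upto x" for a b
    proof -
      define k where "k = gcd a b"
      obtain a' b' where ab': "a = k * a'" "b = k * b'" unfolding k_def by (meson dvdE gcd_dvd1 gcd_dvd2)
      have pos: "k > 0" "a' > 0" "b' > 0" using ab ab' by (auto simp: pairs_upto_iff)
      have cop: "coprime a' b'" using ab' pos div_gcd_coprime[of a b] unfolding k_def[symmetric] by auto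
      have p: "real (k * a') * real (k * b') \<le> x" using ab ab' by (simp add: pairs_upto_iff)
      have "k \<in> nats_upto (sqrt x)" using le[OF pos(2,3) p] pos by (simp add: nats_upto_def)
      moreover have "(a', b') \<in> ?C k" using p pos cop iff[of k a' b'] by (simp add: pairs_upto_iff)
      ultimately show ?thesis using ab' pos unfolding k_def[symmetric] by auto
    qed
    then show ?case by auto
  next
    case (3 z)
    then show ?case by (auto simp: nats_upto_def gcd_mult_distrib_nat[symmetric])
  next
    case (4 z)
    then show ?case by (cases z) auto
  qed
  then have "card (pairs_upto x) = card (SIGMA k:nats_upto (sqrt x). ?C k)"
    by (simp add: bij_betw_same_card)
  also have "\<dots> = (\<Sum>k\<in>nats_upto (sqrt x). card (?C k))"
    by (rule card_SigmaI) (auto intro: finite_subset[OF _ finite_pairs_upto])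
  finally show ?thesis by (simp add: unitary_sum_eq_card)
qed

text \<open>The elementary estimate of the Dirichlet divisor problem. The upper bound loses only
  through \<open>harm n \<le> 1 + ln x\<close>, the lower one only through the floors, which cost at
  most 1 in each of \<open>n\<close> columns; hence the constant 1.\<close>

lemma card_pairs_upto_bound:
  assumes "x \<ge> 1"
  shows "\<bar>real (card (pairs_upto x)) - x * ln x\<bar> \<le> x"
proof -
  define n where "n = nat \<lfloor>x\<rfloor>"
  have n: "n \<ge> 1" "real n \<le> x" "x < real n + 1" using assms by (auto simp: n_def le_nat_floor)
  have c: "real (card (pairs_upto x)) = (\<Sum>a = 1..n. real (nat \<lfloor>x / real a\<rfloor>))"
    unfolding pairs_upto_def by (subst card_SigmaI) (auto simp: nats_upto_eq n_def)
  have fl: "x / real a - 1 \<le> real (nat \<lfloor>x / real a\<rfloor>)" "real (nat \<lfloor>x / real a\<rfloor>) \<le> x / real a" for a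
    using assms by (auto intro: of_nat_floor)
  have s: "(\<Sum>a = 1..n. x / real a) = x * harm n"
    by (simp add: harm_def sum_distrib_left divide_inverse)
  have up: "real (card (pairs_upto x)) \<le> x * harm n"
    unfolding c s[symmetric] by (intro sum_mono fl)
  have "x * harm n - real n = (\<Sum>a = 1..n. x / real a - 1)" by (simp add: sum_subtractf s)
  also have "\<dots> \<le> real (card (pairs_upto x))" unfolding c by (intro sum_mono fl)
  finally have lo: "x * harm n - x \<le> real (card (pairs_upto x))" using n by linarith
  have "ln x \<le> ln (real n + 1)" using assms n by simp
  also have "\<dots> \<le> harm n" using ln_le_harm[of n] by (simp add: add.commute)
  finally have h1: "ln x \<le> harm n" .
  have "harm n \<le> 1 + ln (real n)"
    using n(1)
  proof (induction n rule: nat_induct_at_least)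
    case base
    then show ?case by (simp add: harm_def)
  next
    case (Suc m)
    have "ln (real m / real (Suc m)) \<le> real m / real (Suc m) - 1"
      using Suc by (intro ln_le_minus_one) auto
    then have "ln (real m) - ln (real (Suc m)) \<le> - inverse (real (Suc m))"
      using Suc by (simp add: ln_div field_simps)
    then show ?case using Suc by (simp add: harm_Suc)
  qed
  also have "\<dots> \<le> 1 + ln x" using n by simp
  finally have h2: "harm n \<le> 1 + ln x" .
  have "x * ln x \<le> x * harm n" "x * harm n \<le> x * (1 + ln x)"
    using h1 h2 assms by (auto intro: mult_left_mono)
  then show ?thesis using lo up by (simp add: algebra_simps abs_le_iff)
qed

section \<open>Absorbing the terms with \<open>k \<ge> 2\<close>\<close>

lemma inverse_Suc_square_le:
  fixes t :: real
  assumes "t > 0"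
  shows "1 / (t + 1)\<^sup>2 \<le> 1 / t - 1 / (t + 1)"
proof -
  have "1 / (t + 1)\<^sup>2 \<le> 1 / (t * (t + 1))"
    using assms by (intro divide_left_mono) (auto simp: power2_eq_square)
  also have "\<dots> = 1 / t - 1 / (t + 1)" using assms by (simp add: field_simps)
  finally show ?thesis .
qed

text \<open>Telescoping from \<open>n = 2\<close>, where \<open>1/4 = 3/4 - 1/2\<close> is an
  equality.\<close>

lemma sum_inverse_squares_from_2: "n \<ge> 2 \<Longrightarrow> (\<Sum>k = 2..n. 1 / (real k)\<^sup>2) \<le> 3 / 4 - 1 / real n"
proof (induction n rule: nat_induct_at_least)
  case (Suc n)
  have "1 / (real n + 1)\<^sup>2 \<le> 1 / real n - 1 / (real n + 1)"
    using Suc by (intro inverse_Suc_square_le) simp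
  then show ?case using Suc by (simp add: add.commute)
qed simp

lemma sum_inverse_squares_le:
  assumes "finite A" "\<And>k. k \<in> A \<Longrightarrow> k \<ge> 2"
  shows "(\<Sum>k\<in>A. 1 / (real k)\<^sup>2) \<le> 3 / 4"
proof -
  define n where "n = Max (insert 2 A)"
  have "A \<subseteq> {2..n}" "n \<ge> 2" using assms by (auto simp: n_def)
  then have "(\<Sum>k\<in>A. 1 / (real k)\<^sup>2) \<le> (\<Sum>k = 2..n. 1 / (real k)\<^sup>2)"
    by (intro sum_mono2) auto
  also have "\<dots> \<le> 3 / 4 - 1 / real n" by (rule sum_inverse_squares_from_2) fact
  also have "\<dots> \<le> 3 / 4" by simp
  finally show ?thesis .
qed

text \<open>
  Inducting on the integer part of \<open>x\<close>, the terms \<open>k \<ge> 2\<close> contribute at most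
  \<open>3/4\<close> of the claimed bound, because \<open>1/4 + 1/9 + 1/16 + \<dots> \<le> 3/4 < 1\<close>.
\<close>
lemma contraction_bound:
  fixes e :: "real \<Rightarrow> real"
  assumes C: "\<And>x. x \<ge> 1 \<Longrightarrow> \<bar>\<Sum>k\<in>nats_upto (sqrt x). e (x / (real k)\<^sup>2)\<bar> \<le> C * x"
    and "x \<ge> 1"
  shows "\<bar>e x\<bar> \<le> 4 * C * x"
  using assms(2)
proof (induction "nat \<lfloor>x\<rfloor>" arbitrary: x rule: less_induct)
  case less
  define A where "A = nats_upto (sqrt x) - {1}"
  have A: "nats_upto (sqrt x) = insert 1 A" "1 \<notin> A" "finite A"
    using less(2) by (auto simp: A_def) (simp add: nats_upto_def)
  have C0: "C \<ge> 0" using C[of 1] by (simp add: abs_ge_zero order_trans[OF abs_ge_zero])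
  have IH: "\<bar>e (x / (real k)\<^sup>2)\<bar> \<le> 4 * C * x * (1 / (real k)\<^sup>2)" if "k \<in> A" for k
  proof -
    have k: "k \<ge> 2" "real k \<le> sqrt x" using that by (auto simp: A_def nats_upto_def)
    have "(real k)\<^sup>2 \<le> x"
      using k less(2) by (metis of_nat_0_le_iff power_mono real_sqrt_pow2 order_trans zero_le_one)
    then have y1: "x / (real k)\<^sup>2 \<ge> 1" using k by (simp add: field_simps)
    have "(real k)\<^sup>2 \<ge> 2\<^sup>2" using k by (intro power_mono) auto
    then have "x / (real k)\<^sup>2 \<le> x / 4" using less(2) k(1) by (intro divide_left_mono) auto
    \<comment> \<open>From \<open>1 \<le> y \<le> x / 4\<close> it follows that
      \<open>x - y \<ge> 3 * y \<ge> 3\<close>, so the integer part strictly drops and the induction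
      applies.\<close>
    then have "x / (real k)\<^sup>2 \<le> x - 1" using y1 by linarith
    then have "\<lfloor>x / (real k)\<^sup>2\<rfloor> < \<lfloor>x\<rfloor>" by linarith
    then have "nat \<lfloor>x / (real k)\<^sup>2\<rfloor> < nat \<lfloor>x\<rfloor>" using y1 by linarith
    from less(1)[OF this y1] show ?thesis by simp
  qed
  have "e x = (\<Sum>k\<in>nats_upto (sqrt x). e (x / (real k)\<^sup>2)) - (\<Sum>k\<in>A. e (x / (real k)\<^sup>2))"
    using A by simp
  then have "\<bar>e x\<bar> \<le> C * x + \<bar>\<Sum>k\<in>A. e (x / (real k)\<^sup>2)\<bar>"
    using C[OF less(2)] by linarith
  also have "\<bar>\<Sum>k\<in>A. e (x / (real k)\<^sup>2)\<bar> \<le> (\<Sum>k\<in>A. 4 * C * x * (1 / (real k)\<^sup>2))"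
    by (rule order_trans[OF sum_abs sum_mono]) (rule IH)
  also have "\<dots> = 4 * C * x * (\<Sum>k\<in>A. 1 / (real k)\<^sup>2)" by (simp add: sum_distrib_left)
  \<comment> \<open>The factor 4 is \<open>1 / (1 - 3/4)\<close>: the total is
    \<open>C * x + 3 * C * x\<close>.\<close>
  also have "\<dots> \<le> 4 * C * x * (3 / 4)"
    using A C0 less(2) by (intro mult_left_mono sum_inverse_squares_le) (auto simp: A_def nats_upto_def)
  finally show ?case by simp
qed

section \<open>The main term\<close>

text \<open>The Basel series has positive terms, and its tail beyond \<open>M\<close> telescopes to
  at most \<open>1 / M\<close>.\<close>

lemma inverse_squares_partial_sum:
  assumes "M \<ge> 1"
  shows "(\<Sum>k = 1..M. 1 / (real k)\<^sup>2) \<le> pi\<^sup>2 / 6"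
    and "pi\<^sup>2 / 6 \<le> (\<Sum>k = 1..M. 1 / (real k)\<^sup>2) + 1 / real M"
proof -
  let ?s = "\<lambda>n. \<Sum>k = 1..n. 1 / (real k)\<^sup>2"
  have "(\<lambda>n. \<Sum>k<n. 1 / (real k + 1)\<^sup>2) \<longlonglongrightarrow> pi\<^sup>2 / 6"
    using inverse_squares_sums by (simp add: sums_def)
  moreover have "(\<Sum>k<n. 1 / (real k + 1)\<^sup>2) = ?s n" for n
    by (induction n) (auto simp: add.commute)
  ultimately have lim: "?s \<longlonglongrightarrow> pi\<^sup>2 / 6" by simp
  show "?s M \<le> pi\<^sup>2 / 6"
    by (rule LIMSEQ_le_const[OF lim]) (auto intro!: exI[of _ M] sum_mono2)
  have "?s n \<le> ?s M + 1 / real M - 1 / real n" if "n \<ge> M" for n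
    using that
  proof (induction n rule: nat_induct_at_least)
    case (Suc n)
    have "1 / (real n + 1)\<^sup>2 \<le> 1 / real n - 1 / (real n + 1)"
      using Suc assms by (intro inverse_Suc_square_le) simp
    then show ?case using Suc by (simp add: add.commute)
  qed simp
  then have "?s n \<le> ?s M + 1 / real M" if "n \<ge> M" for n
    using that by (smt (verit) of_nat_0_le_iff divide_nonneg_nonneg)
  then show "pi\<^sup>2 / 6 \<le> ?s M + 1 / real M"
    by (intro LIMSEQ_le_const2[OF lim]) blast
qed

lemma ex_bound_sum_ln_over_square: "\<exists>B. \<forall>M. (\<Sum>k = 1..M. ln (real k) / (real k)\<^sup>2) \<le> B"
proof -
  have "summable (\<lambda>k. real k powr (- 3 / 2))" by (subst summable_real_powr_iff) simp
  moreover have "eventually (\<lambda>k. norm (ln (real k) / (real k)\<^sup>2) \<le> real k powr (- 3 / 2)) sequentially"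
    unfolding real_norm_def by real_asymp
  ultimately have s: "summable (\<lambda>k. ln (real k) / (real k)\<^sup>2)"
    by (rule summable_comparison_test_ev[rotated])
  have "0 \<le> ln (real k) / (real k)\<^sup>2" for k
    by (cases "k = 0") (auto simp: Suc_le_eq)
  then have "(\<Sum>k = 1..M. ln (real k) / (real k)\<^sup>2) \<le> (\<Sum>k. ln (real k) / (real k)\<^sup>2)" for M
    by (intro sum_le_suminf[OF s]) auto
  then show ?thesis by blast
qed

text \<open>Expanding \<open>ln (x / k^2) = ln x - 2 * ln k\<close> splits off a bounded sum of
  \<open>ln k / k^2\<close>. Cutting the Basel series at about \<open>sqrt x\<close> costs
  \<open>ln x / sqrt x\<close> up to a constant factor, which is bounded.\<close>

lemma ex_bound_main_term:
  "\<exists>C. \<forall>x\<ge>1. \<bar>(\<Sum>k\<in>nats_upto (sqrt x). x / (real k)\<^sup>2 * ln (x / (real k)\<^sup>2)) - pi\<^sup>2 / 6 * (x * ln x)\<bar> \<le> C * x"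
proof -
  obtain B where B: "\<And>M. (\<Sum>k = 1..M. ln (real k) / (real k)\<^sup>2) \<le> B"
    using ex_bound_sum_ln_over_square by blast
  show ?thesis
  proof (intro exI[of _ "4 + 2 * B"] allI impI)
    fix x :: real assume x: "x \<ge> 1"
    define M where "M = nat \<lfloor>sqrt x\<rfloor>"
    define S where "S = (\<Sum>k = 1..M. 1 / (real k)\<^sup>2)"
    define T where "T = (\<Sum>k = 1..M. ln (real k) / (real k)\<^sup>2)"
    have sx: "sqrt x \<ge> 1" using x by simp
    have M: "M \<ge> 1" "sqrt x < real M + 1" using sx by (auto simp: M_def le_nat_floor)
    have T: "0 \<le> T" "T \<le> B" using B by (auto simp: T_def intro!: sum_nonneg divide_nonneg_nonneg)
    have "(\<Sum>k\<in>nats_upto (sqrt x). x / (real k)\<^sup>2 * ln (x / (real k)\<^sup>2))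
        = (\<Sum>k = 1..M. x * ln x * (1 / (real k)\<^sup>2) - 2 * x * (ln (real k) / (real k)\<^sup>2))"
      unfolding nats_upto_eq M_def using x
      by (intro sum.cong refl) (simp add: ln_div ln_realpow algebra_simps diff_divide_distrib)
    also have "\<dots> = x * ln x * S - 2 * x * T"
      by (simp add: sum_subtractf sum_distrib_left S_def T_def)
    finally have eq: "(\<Sum>k\<in>nats_upto (sqrt x). x / (real k)\<^sup>2 * ln (x / (real k)\<^sup>2)) - pi\<^sup>2 / 6 * (x * ln x)
        = - x * (ln x * (pi\<^sup>2 / 6 - S) + 2 * T)"
      by (simp add: algebra_simps)
    \<comment> \<open>Here \<open>ln x \<le> 2 * (sqrt x - 1) < 2 * M\<close>, well within the bound
      \<open>4 * M\<close> that gives the 4 in the constant.\<close>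
    have lx: "ln x = 2 * ln (sqrt x)" using x by (simp add: ln_sqrt)
    have "ln (sqrt x) \<le> sqrt x - 1" using sx by (intro ln_le_minus_one) simp
    then have "ln x \<le> 4 * real M" using lx M by simp
    then have "ln x * (1 / real M) \<le> 4" using M by (simp add: field_simps)
    moreover have "ln x * (pi\<^sup>2 / 6 - S) \<le> ln x * (1 / real M)"
      using x inverse_squares_partial_sum(2)[OF M(1)] by (intro mult_left_mono) (auto simp: S_def)
    moreover have "0 \<le> ln x * (pi\<^sup>2 / 6 - S)"
      using x inverse_squares_partial_sum(1)[OF M(1)] by (auto simp: S_def)
    ultimately have "\<bar>ln x * (pi\<^sup>2 / 6 - S) + 2 * T\<bar> \<le> 4 + 2 * B" using T by linarith
    then show "\<bar>(\<Sum>k\<in>nats_upto (sqrt x). x / (real k)\<^sup>2 * ln (x / (real k)\<^sup>2)) - pi\<^sup>2 / 6 * (x * ln x)\<bar> \<le> (4 + 2 * B) * x"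
      unfolding eq using x by (simp add: abs_mult mult.commute)
  qed
qed

section \<open>From the error bound to the asymptotics\<close>

text \<open>The constant \<open>c\<close> is the inverse of the Basel sum, so in the sum of
  \<open>e (x / k^2)\<close> the terms \<open>x * ln x\<close> cancel and
  \<open>contraction_bound\<close> applies.\<close>

lemma unitary_sum_bound:
  "\<exists>K. \<forall>x\<ge>1. \<bar>unitary_sum x - 6 / pi\<^sup>2 * (x * ln x)\<bar> \<le> K * x"
proof -
  obtain C where C: "\<And>x. x \<ge> 1 \<Longrightarrow> \<bar>(\<Sum>k\<in>nats_upto (sqrt x). x / (real k)\<^sup>2 * ln (x / (real k)\<^sup>2)) - pi\<^sup>2 / 6 * (x * ln x)\<bar> \<le> C * x"
    using ex_bound_main_term by blast
  define c where "c = 6 / pi\<^sup>2"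
  define e where "e x = unitary_sum x - c * (x * ln x)" for x
  have c: "c > 0" "c * (pi\<^sup>2 / 6) = 1" by (auto simp: c_def)
  have "\<bar>\<Sum>k\<in>nats_upto (sqrt x). e (x / (real k)\<^sup>2)\<bar> \<le> (1 + c * C) * x" if x: "x \<ge> 1" for x
  proof -
    define S where "S = (\<Sum>k\<in>nats_upto (sqrt x). x / (real k)\<^sup>2 * ln (x / (real k)\<^sup>2))"
    have "(\<Sum>k\<in>nats_upto (sqrt x). e (x / (real k)\<^sup>2)) = real (card (pairs_upto x)) - c * S"
      by (simp only: e_def sum_subtractf card_pairs_upto_gcd[OF x] S_def sum_distrib_left)
    also have "\<dots> = (real (card (pairs_upto x)) - x * ln x) - c * (S - pi\<^sup>2 / 6 * (x * ln x))"
      using c(2) by (simp add: right_diff_distrib mult.assoc[symmetric])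
    also have "\<bar>\<dots>\<bar> \<le> x + c * (C * x)"
    proof -
      have "\<bar>c * (S - pi\<^sup>2 / 6 * (x * ln x))\<bar> \<le> c * (C * x)"
        using c(1) C[OF x] unfolding S_def[symmetric] by (simp add: abs_mult)
      then show ?thesis using card_pairs_upto_bound[OF x] by linarith
    qed
    finally show ?thesis by (simp add: algebra_simps)
  qed
  from contraction_bound[OF this] show ?thesis unfolding e_def c_def by blast
qed

text \<open>The leading constant survives because \<open>1 - 1/2 + 2/4 = 1\<close>. The errors add
  up to \<open>K * (1 + 1/2 + 2/4) = 2 * K\<close> times \<open>x\<close>, and
  \<open>x \<ge> 4\<close> keeps \<open>x / 4\<close> in the range of the previous bound.\<close>

lemma sum_g_bound:
  "\<exists>K. \<forall>x\<ge>4. \<bar>(\<Sum>d\<in>nats_upto x. real (g d)) - 6 / pi\<^sup>2 * (x * ln x)\<bar> \<le> K * x"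
proof -
  define c where "c = 6 / pi\<^sup>2"
  obtain K where K: "\<And>x. x \<ge> 1 \<Longrightarrow> \<bar>unitary_sum x - c * (x * ln x)\<bar> \<le> K * x"
    using unitary_sum_bound unfolding c_def by blast
  have c: "c > 0" by (simp add: c_def)
  show ?thesis unfolding c_def[symmetric]
  proof (intro exI[of _ "2 * K + c * ln 2"] allI impI)
    fix x :: real assume x: "x \<ge> 4"
    have "ln (x / 4) = ln x - ln (2 ^ 2)" using x by (simp add: ln_div)
    then have l4: "ln (x / 4) = ln x - 2 * ln 2" by (simp only: ln_realpow)
    have l2: "ln (x / 2) = ln x - ln 2" using x by (simp add: ln_div)
    define u where "u = c * (x * ln x)"
    define v where "v = c * (x * ln 2)"
    have v: "v \<ge> 0" using c x by (simp add: v_def)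
    have "c * (x / 2 * ln (x / 2)) = u / 2 - v / 2" "c * (x / 4 * ln (x / 4)) = u / 4 - v / 2"
      by (simp_all add: l2 l4 u_def v_def field_simps)
    then have "\<bar>unitary_sum x - u\<bar> \<le> K * x" "\<bar>unitary_sum (x / 2) - (u / 2 - v / 2)\<bar> \<le> K * x / 2"
       "\<bar>unitary_sum (x / 4) - (u / 4 - v / 2)\<bar> \<le> K * x / 4"
      using K[of x] K[of "x / 2"] K[of "x / 4"] x by (auto simp: u_def diff_divide_distrib)
    then have "\<bar>(\<Sum>d\<in>nats_upto x. real (g d)) - u\<bar> \<le> 2 * (K * x) + v"
      unfolding sum_g_conv using v by linarith
    then show "\<bar>(\<Sum>d\<in>nats_upto x. real (g d)) - c * (x * ln x)\<bar> \<le> (2 * K + c * ln 2) * x"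
      by (simp add: u_def v_def algebra_simps)
  qed
qed

theorem theorem2:
  shows "(\<lambda>N::nat. real (\<Sum>d\<in>{1..<N}. g d)) \<sim>[at_top]
         (\<lambda>N. 6 / pi\<^sup>2 * real N * ln (real N))"
proof -
  obtain K where K: "\<And>x. x \<ge> 4 \<Longrightarrow> \<bar>(\<Sum>d\<in>nats_upto x. real (g d)) - 6 / pi\<^sup>2 * (x * ln x)\<bar> \<le> K * x"
    using sum_g_bound by blast
  let ?f = "\<lambda>N::nat. real (\<Sum>d\<in>{1..<N}. g d)"
  \<comment> \<open>The sum over \<open>d < N\<close> has cutoff \<open>N - 1\<close>, so the
    comparison is first made there, with \<open>N \<ge> 5\<close> giving
    \<open>N - 1 \<ge> 4\<close>.\<close>
  let ?h = "\<lambda>N::nat. 6 / pi\<^sup>2 * ((real N - 1) * ln (real N - 1))"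
  have "norm (?f N - ?h N) \<le> K * norm (real N - 1)" if N: "N \<ge> 5" for N
  proof -
    have "nats_upto (real N - 1) = {1..<N}" by (auto simp: nats_upto_def)
    then show ?thesis using K[of "real N - 1"] N by simp
  qed
  then have "(\<lambda>N. ?f N - ?h N) \<in> O(\<lambda>N. real N - 1)"
    by (intro bigoI[of _ K] eventually_mono[OF eventually_ge_at_top[of 5]])
  also have "(\<lambda>N. real N - 1) \<in> o(?h)" by real_asymp
  finally have "?f \<sim>[at_top] ?h" by (rule smallo_imp_asymp_equiv)
  also have "?h \<sim>[at_top] (\<lambda>N. 6 / pi\<^sup>2 * real N * ln (real N))" by real_asymp
  finally show ?thesis .
qed

end
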